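(* Let $a,b$ be integers with $\gcd(a,b)=1$. A positive integer $n$ satisfies $n\mid a^n-b^n$ if and only if its prime factorization can be written in the form $$n=p_1^{k_1}p_2^{k_2}\cdots p_r^{k_r}\qquad (r\ge 0,\ p_1<p_2<\dots<p_r \text{ primes},\ \text{all } k_i\ge 1),$$ where $p_i\mid a^{n_i}-b^{n_i}$ for $i=1,\dots,r$, with $n_1=1$ and $n_i=p_1^{k_1}p_2^{k_2}\cdots p_{i-1}^{k_{i-1}}$ for $i=2,\dots,r$. (Here the $k_i$ are arbitrary positive integers; $n=1$ corresponds to $r=0$.)
   Context: For integers $a,b$ and $j\ge 1$, $R^{(j)}_{a,b}$ denotes the set of positive integers $n$ such that $n^j$ divides $a^n-b^n$; the theorem describes $R^{(1)}_{a,b}$. *)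

theory Defs
  imports "HOL-Number_Theory.Number_Theory"
begin

end

theory Submission
  imports Defs
begin

text \<open>
  If \<open>n\<close> divides \<open>a ^ n - b ^ n\<close> and \<open>p\<close> is a prime factor of \<open>n\<close>, then \<open>a ^ t \<equiv> b ^ t\<close> modulo \<open>p\<close>
  for \<open>t = n\<close>, and for \<open>t = p - 1\<close> by Fermat, hence for \<open>t = gcd n (p - 1)\<close>. All prime factors of
  this \<open>t\<close> are below \<open>p\<close>, so it divides the part of \<open>n\<close> composed of the primes below \<open>p\<close>.
  Conversely, if \<open>N\<close> and \<open>p\<close> both divide \<open>a ^ N - b ^ N\<close>, then \<open>N * p\<close> divides \<open>a ^ (N * p) - b ^ (N * p)\<close>,
  so the prime powers can be multiplied on one at a time.
\<close>

lemma cong_power_gcd: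
  fixes a b m :: int and s t :: nat
  assumes "[a ^ s = b ^ s] (mod m)" "[a ^ t = b ^ t] (mod m)" and "coprime a m" and "s > 0"
  shows "[a ^ gcd s t = b ^ gcd s t] (mod m)"
proof -
  obtain x y where xy: "s * x = t * y + gcd s t"
    using bezout_nat[of s t] assms(4) by auto
  have "[a ^ (s * x) = b ^ (s * x)] (mod m)" and ty: "[a ^ (t * y) = b ^ (t * y)] (mod m)"
    using assms(1,2) by (auto simp: power_mult intro: cong_pow)
  then have "[a ^ (t * y) * a ^ gcd s t = b ^ (t * y) * b ^ gcd s t] (mod m)"
    by (simp add: xy power_add)
  \<comment> \<open>Exchanging \<open>b ^ (t * y)\<close> for \<open>a ^ (t * y)\<close> puts the
    same invertible factor on both sides.\<close>
  also have "[b ^ (t * y) * b ^ gcd s t = a ^ (t * y) * b ^ gcd s t] (mod m)"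
    using ty by (intro cong_mult cong_refl) (rule cong_sym)
  finally show ?thesis
    using assms(3) by (subst (asm) cong_mult_lcancel) auto
qed

lemma power_diff_dvd_power_diff:
  fixes a b :: "'a::comm_ring_1"
  assumes "m dvd n"
  shows "a ^ m - b ^ m dvd a ^ n - b ^ n"
proof -
  from assms obtain c where "n = m * c" ..
  then show ?thesis
    by (simp add: power_mult power_diff_sumr2[of "a ^ m"])
qed

text \<open>In the application \<open>m\<close> collects the prime powers below \<open>p\<close>,
  and \<open>M\<close> those from \<open>p\<close> on.\<close>

lemma prime_dvd_power_diff_lower_part:
  fixes a b :: int and p m M :: nat
  assumes "coprime a b" and p: "prime p" and "m * M > 0" and "p dvd M"
    and M: "\<And>q. prime q \<Longrightarrow> q dvd M \<Longrightarrow> p \<le> q"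
    and dvd: "int (m * M) dvd a ^ (m * M) - b ^ (m * M)"
  shows "int p dvd a ^ m - b ^ m"
proof -
  let ?n = "m * M" and ?p = "int p"
  have pp: "prime ?p" using p by simp
  have "?p dvd a ^ ?n - b ^ ?n"
    using dvd \<open>p dvd M\<close> by (meson dvd_mult dvd_trans of_nat_dvd_iff)
  then have n: "[a ^ ?n = b ^ ?n] (mod ?p)"
    by (simp add: cong_iff_dvd_diff)
  \<comment> \<open>If \<open>p\<close> divided one of \<open>a\<close> and \<open>b\<close>, it
    would divide both, against coprimality.\<close>
  then have "?p dvd a \<longleftrightarrow> ?p dvd b"
    using pp \<open>?n > 0\<close> cong_dvd_iff[OF n] by (simp only: prime_dvd_power_iff)
  with \<open>coprime a b\<close> pp have na: "\<not> ?p dvd a" and nb: "\<not> ?p dvd b"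
    by (auto simp: not_prime_unit dest: coprime_common_divisor)
  have fermat: "[x ^ (p - 1) = 1] (mod ?p)" if "\<not> ?p dvd x" for x :: int
  proof -
    have "coprime x ?p"
      using prime_imp_coprime[OF pp that] by (simp add: coprime_commute)
    moreover have "residues ?p"
      using prime_gt_1_nat[OF p] by (simp add: residues_def)
    ultimately have "[x ^ totient p = 1] (mod ?p)"
      using residues.euler_theorem[of ?p x] by simp
    then show ?thesis using p by (simp add: totient_prime)
  qed
  \<comment> \<open>For the exponent \<open>p - 1\<close> both powers are congruent to 1.\<close>
  have "[a ^ gcd ?n (p - 1) = b ^ gcd ?n (p - 1)] (mod ?p)"
    using n fermat[OF na] fermat[OF nb] \<open>?n > 0\<close> prime_imp_coprime[OF pp na]
    by (intro cong_power_gcd) (auto intro: cong_trans cong_sym simp: coprime_commute)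
  then have "?p dvd a ^ gcd ?n (p - 1) - b ^ gcd ?n (p - 1)"
    by (simp add: cong_iff_dvd_diff)
  moreover have "a ^ gcd ?n (p - 1) - b ^ gcd ?n (p - 1) dvd a ^ m - b ^ m"
  proof -
    have "coprime (p - 1) M"
    proof (rule ccontr)
      assume "\<not> coprime (p - 1) M"
      then obtain q where q: "prime q" "q dvd p - 1" "q dvd M"
        by (metis coprime_iff_gcd_eq_1 gcd_nat.boundedE prime_factor_nat)
      have "q \<le> p - 1"
        using q(2) prime_gt_1_nat[OF p] by (intro dvd_imp_le) auto
      with M[OF q(1,3)] prime_gt_1_nat[OF p] show False by simp
    qed
    then have "coprime (gcd ?n (p - 1)) M"
      by (meson coprime_divisors dvd_refl gcd_dvd2)
    then have "gcd ?n (p - 1) dvd m"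
      using coprime_dvd_mult_left_iff gcd_dvd1 by blast
    then show ?thesis
      by (rule power_diff_dvd_power_diff)
  qed
  ultimately show ?thesis
    by (rule dvd_trans)
qed

text \<open>The cofactor of \<open>x - y\<close> in \<open>x ^ p - y ^ p\<close> is a sum of
  \<open>p\<close> terms, each congruent to \<open>y ^ (p - 1)\<close> modulo \<open>p\<close>, so
  it contributes the factor \<open>p\<close>.\<close>

lemma mult_dvd_power_diff:
  fixes x y :: int and N p :: nat
  assumes "int N dvd x - y" "int p dvd x - y"
  shows "int (N * p) dvd x ^ p - y ^ p"
proof -
  have xy: "[x = y] (mod int p)"
    using assms(2) by (simp add: cong_iff_dvd_diff)
  have "[(\<Sum>i<p. y ^ (p - Suc i) * x ^ i) = (\<Sum>i<p. y ^ (p - 1))] (mod int p)"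
  proof (rule cong_sum)
    fix i assume "i \<in> {..<p}"
    then have "y ^ (p - 1) = y ^ (p - Suc i) * y ^ i"
      by (simp flip: power_add)
    then show "[y ^ (p - Suc i) * x ^ i = y ^ (p - 1)] (mod int p)"
      using xy by (simp add: cong_mult cong_pow)
  qed
  then have "int p dvd (\<Sum>i<p. y ^ (p - Suc i) * x ^ i)"
    by (simp add: cong_dvd_iff cong_sym_eq)
  then show ?thesis
    using assms(1) by (simp add: power_diff_sumr2 mult_dvd_mono)
qed

lemma mult_power_dvd_power_diff:
  fixes a b :: int and N p k :: nat
  assumes "int N dvd a ^ N - b ^ N" "int p dvd a ^ N - b ^ N"
  shows "int (N * p ^ k) dvd a ^ (N * p ^ k) - b ^ (N * p ^ k)"
proof (induction k)
  case 0
  then show ?case using assms by simp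
next
  case (Suc k)
  \<comment> \<open>Divisibility by \<open>p\<close> survives the growth of the exponent, as
    \<open>N\<close> divides \<open>N * p ^ k\<close>.\<close>
  have "int p dvd a ^ (N * p ^ k) - b ^ (N * p ^ k)"
    using assms(2) power_diff_dvd_power_diff[OF dvd_triv_left] by (rule dvd_trans)
  from mult_dvd_power_diff[OF Suc.IH this] show ?case
    by (simp add: mult_ac flip: power_mult)
qed

lemma strict_mono_prime_factorization:
  fixes n :: nat
  assumes "n > 0"
  obtains r :: nat and p k :: "nat \<Rightarrow> nat" where
    "\<And>i. i \<in> {1..r} \<Longrightarrow> prime (p i)" "\<And>i. i \<in> {1..r} \<Longrightarrow> k i \<ge> 1"
    "strict_mono_on {1..r} p" "n = (\<Prod>i=1..r. p i ^ k i)"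
proof -
  let ?c = "card (prime_factors n)"
  obtain h where h: "bij_betw h {..<?c} (prime_factors n)" "strict_mono_on {..<?c} h"
    by (rule ex_bij_betw_strict_mono_card[OF finite_set_mset])
  \<comment> \<open>The index shift turns the enumeration from 0 into one from 1.\<close>
  define p where "p i = h (i - 1)" for i
  have "bij_betw (\<lambda>i. i - 1) {1..?c} {..<?c}"
    by (rule bij_betwI[where g = Suc]) auto
  from bij_betw_trans[OF this h(1)] have bij: "bij_betw p {1..?c} (prime_factors n)"
    by (simp add: p_def[abs_def] comp_def)
  have mono: "strict_mono_on {1..?c} p"
    by (rule strict_mono_onI) (auto simp: p_def intro!: strict_mono_onD[OF h(2)])
  show thesis
  proof (rule that[of "?c" p "\<lambda>i. multiplicity (p i) n"])
    fix i assume "i \<in> {1..?c}"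
    then have pf: "p i \<in> prime_factors n"
      using bij by (simp add: bij_betw_apply)
    then show "prime (p i)" by auto
    show "multiplicity (p i) n \<ge> 1"
      using pf by (auto simp: prime_factors_multiplicity)
  next
    show "n = (\<Prod>i=1..?c. p i ^ multiplicity (p i) n)"
      using prime_factorization_nat[OF assms] prod.reindex_bij_betw[OF bij, of "\<lambda>q. q ^ multiplicity q n"]
      by simp
  qed (fact mono)
qed

theorem theorem1:
  fixes a b :: int and n :: nat
  assumes "gcd a b = 1"
    and "n > 0"
  shows "int n dvd a ^ n - b ^ n \<longleftrightarrow>
    (\<exists>(r::nat) (p::nat \<Rightarrow> nat) (k::nat \<Rightarrow> nat).
        (\<forall>i\<in>{1..r}. prime (p i) \<and> k i \<ge> 1) \<and>
        strict_mono_on {1..r} p \<and>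
        n = (\<Prod>i=1..r. p i ^ k i) \<and>
        (\<forall>i\<in>{1..r}.
          int (p i) dvd a ^ (\<Prod>j=1..<i. p j ^ k j) - b ^ (\<Prod>j=1..<i. p j ^ k j)))"
    (is "_ \<longleftrightarrow> ?R")
proof
  assume dvd: "int n dvd a ^ n - b ^ n"
  obtain r and p k :: "nat \<Rightarrow> nat" where pk: "\<And>i. i \<in> {1..r} \<Longrightarrow> prime (p i)" "\<And>i. i \<in> {1..r} \<Longrightarrow> k i \<ge> 1"
    and mono: "strict_mono_on {1..r} p" and n: "n = (\<Prod>i=1..r. p i ^ k i)"
    using strict_mono_prime_factorization[OF \<open>n > 0\<close>] by blast
  have "int (p i) dvd a ^ (\<Prod>j=1..<i. p j ^ k j) - b ^ (\<Prod>j=1..<i. p j ^ k j)" if i: "i \<in> {1..r}" for i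
  proof -
    \<comment> \<open>Cut the factorization just before \<open>p i\<close>; by monotonicity all
      primes of the second part are at least \<open>p i\<close>.\<close>
    have "{1..r} = {1..<i} \<union> {i..r}" using i by auto
    then have split: "n = (\<Prod>j=1..<i. p j ^ k j) * (\<Prod>j=i..r. p j ^ k j)"
      unfolding n by (simp only:) (subst prod.union_disjoint, auto)
    show ?thesis
    proof (rule prime_dvd_power_diff_lower_part[where M = "\<Prod>j=i..r. p j ^ k j"])
      show "coprime a b" using assms(1) by (simp add: coprime_iff_gcd_eq_1)
      show "p i dvd (\<Prod>j=i..r. p j ^ k j)"
        using i pk(2)[OF i] dvd_prodI[of "{i..r}" i "\<lambda>j. p j ^ k j"]
        by (auto intro: dvd_trans[OF dvd_power])
      fix q assume q: "prime q" "q dvd (\<Prod>j=i..r. p j ^ k j)"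
      then obtain j where j: "j \<in> {i..r}" "q dvd p j ^ k j"
        by (auto simp: prime_dvd_prod_iff)
      with i have "j \<in> {1..r}" by auto
      with j q(1) pk(1) have "q = p j"
        by (meson prime_dvd_power primes_dvd_imp_eq)
      then show "p i \<le> q"
        using strict_mono_on_leD[OF mono i \<open>j \<in> {1..r}\<close>] j(1) by simp
    qed (use pk(1)[OF i] dvd \<open>n > 0\<close> in \<open>simp_all only: split\<close>)
  qed
  with pk mono n show ?R by blast
next
  assume ?R
  then obtain r and p k :: "nat \<Rightarrow> nat" where n: "n = (\<Prod>i=1..r. p i ^ k i)"
    and p: "\<And>i. i \<in> {1..r} \<Longrightarrow>
      int (p i) dvd a ^ (\<Prod>j=1..<i. p j ^ k j) - b ^ (\<Prod>j=1..<i. p j ^ k j)"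
    by blast
  \<comment> \<open>\<open>N i\<close> omits the \<open>i\<close>-th prime power:
    \<open>N 1 = 1\<close> and \<open>N (Suc r) = n\<close>, so the induction runs over
    \<open>N (Suc i)\<close>.\<close>
  define N where "N i = (\<Prod>j=1..<i. p j ^ k j)" for i
  have "int (N (Suc i)) dvd a ^ N (Suc i) - b ^ N (Suc i)" if "i \<le> r" for i
    using that
  proof (induction i)
    case 0
    then show ?case by (simp add: N_def)
  next
    case (Suc i)
    have "N (Suc (Suc i)) = N (Suc i) * p (Suc i) ^ k (Suc i)"
      by (simp add: N_def)
    with mult_power_dvd_power_diff[OF Suc.IH] p[of "Suc i"] Suc.prems show ?case
      by (simp only: N_def) simp
  qed
  from this[of r] show "int n dvd a ^ n - b ^ n"
    by (simp add: N_def n atLeastLessThanSuc_atLeastAtMost)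
qed

end
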